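(* An LDQL query of the form $(q_1\,\mathsf{AND}\,q_2\,\mathsf{AND}\cdots\mathsf{AND}\,q_m)$ is Web-safe if there exists a total order $\prec$ over the set of subqueries $\{q_1,q_2,\dots,q_m\}$ such that for each subquery $q_i$ ($1\le i\le m$) it holds that either (i) $q_i$ is Web-safe, or (ii) $q_i$ is of the form $(\mathsf{SEED}\ ?v\ q)$ where $q$ is Web-safe and $?v\in\bigcup_{q_j\prec q_i}\mathrm{sbvars}(q_j)$.
   Context: **Data model.** $\mathcal U$ (URIs), $\mathcal B$ (blank nodes), $\mathcal L$ (literals), $\mathcal V$ (variables, written $?v,?x,\dots$) and $\mathcal D$ (documents) are pairwise disjoint infinite sets. An RDF triple is an element of $\mathcal T=(\mathcal U\cup\mathcal B)\times\mathcal U\times(\mathcal U\cup\mathcal B\cup\mathcal L)$; $\mathrm{uris}(t)$ is the set of URIs in the triple $t$. Each document $d$ carries a finite set of triples $\mathrm{data}(d)\subseteq\mathcal T$, distinct documents using disjoint sets of blank nodes. A Web of Linked Data is $W=\langle D,adoc\rangle$ with $D\subseteq\mathcal D$ finite and $adoc:\mathcal U\to D$ a partial surjective function with domain $\mathrm{dom}(adoc)$. The link graph $\mathcal G_W$ has node set $D$ and edges $\langle d,(t,u),d'\rangle$ for all $d\in D$, $t\in\mathrm{data}(d)$, $u\in\mathrm{uris}(t)\cap\mathrm{dom}(adoc)$, $d'=adoc(u)$. **SPARQL.** A solution mapping $\mu$ is a partial function with finite domain from $\mathcal V$ to $\mathcal U\cup\mathcal B\cup\mathcal L$; $\mu[\alpha]=\mu(\alpha)$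 if $\alpha\in\mathrm{dom}(\mu)$, else $\mu[\alpha]=\alpha$ (extended componentwise to triples). $\mu,\mu'$ are compatible if they agree on $\mathrm{dom}(\mu)\cap\mathrm{dom}(\mu')$. $\Omega_1\Join\Omega_2=\{\mu_1\cup\mu_2\mid\mu_i\in\Omega_i\text{ compatible}\}$. An RDF dataset $\mathfrak D$ consists of a default graph and finitely or infinitely many named graphs $\langle u,G_u\rangle$ with pairwise distinct names $u\in\mathcal U$. Graph patterns: finite sets $B$ of triple patterns from $(\mathcal U\cup\mathcal L\cup\mathcal V)\times(\mathcal U\cup\mathcal V)\times(\mathcal U\cup\mathcal L\cup\mathcal V)$ (basic graph patterns, possibly the empty one $\{\,\}$; a triple pattern is identified with a singleton), and $(P_1\,\mathsf{AND}\,P_2)$, $(P_1\,\mathsf{UNION}\,P_2)$, $(P_1\,\mathsf{OPT}\,P_2)$, $(P_1\,\mathsf{FILTER}\,R)$, $(\mathsf{GRAPH}\ c\ P_1)$ with $c\in\mathcal U\cup\mathcal V$, $(P_1\,\mathsf{BIND}(e\,\mathsf{AS}\,?v))$ with $e\in\mathcal U\cup\mathcal L\cup\mathcal V$ and $?v$ not occurring in $P_1$. Filter conditions are Boolean combinations of $\mathrm{bound}(?x)$, $?x=c$, $?x=?y$ (atoms with an unbound variable are false). Evaluation $[\![P]\!]^{\mathfrak D}_G$: $[\![B]\!]=\{\mu\mid\mathrm{dom}(\mu)=\mathrm{var}(B),\mu[B]\subseteq G\}$; $\mathsf{AND}$ is $\Join$; $\mathsf{UNION}$ is $\cup$; $\mathsf{OPT}$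 gives $(\Omega_1\Join\Omega_2)\cup\{\mu\in\Omega_1\mid\text{no }\mu'\in\Omega_2\text{ compatible with }\mu\}$; $\mathsf{FILTER}$ selects the mappings satisfying $R$; $[\![\mathsf{GRAPH}\ u\ P_1]\!]^{\mathfrak D}_G=[\![P_1]\!]^{\mathfrak D}_{G_u}$ ($G_u=\emptyset$ if $u$ is not a name in $\mathfrak D$); $[\![\mathsf{GRAPH}\ ?x\ P_1]\!]^{\mathfrak D}_G=\bigcup_{u\text{ name in }\mathfrak D}([\![P_1]\!]^{\mathfrak D}_{G_u}\Join\{\{?x\mapsto u\}\})$; $\mathsf{BIND}$ extends each mapping $\mu$ by $?v\mapsto\mu[e]$ (leaving $\mu$ unchanged if $e$ is an unbound variable). **LDQL.** A link pattern is a tuple in $(\mathcal U\cup\{\_,+\})\times(\mathcal U\cup\{\_,+\})\times(\mathcal U\cup\mathcal L\cup\{\_,+\})$. An edge with label $(\langle x_1,x_2,x_3\rangle,u)$ matches $\langle y_1,y_2,y_3\rangle$ in the context of URI $u_c$ if (1) some $i$ has $y_i=\_$ and $x_i=u$, and (2) for each $i$: $y_i=+$ and $x_i=u_c$, or $y_i=x_i$, or $y_i=\_$. LDQL queries $q$ and link path expressions (LPEs) $lpe$ are given by $q:=\langle lpe,P\rangle\mid(\mathsf{SEED}\ U\ q)\mid(\mathsf{SEED}\ ?v\ q)\mid(q\,\mathsf{AND}\,q)\mid(q\,\mathsf{UNION}\,q)\mid\pi_Vq$, $lpe:=\varepsilon\mid lp\mid lpe/lpe\mid lpe|lpe\mid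 lpe^*\mid[lpe]\mid\langle ?v,q\rangle$, with $lp$ a link pattern, $P$ a graph pattern, $U$ a finite set of URIs, $V$ a finite set of variables. $\mathrm{dataset}_W(U)$ is the dataset with default graph $\bigcup_{u\in U\cap\mathrm{dom}(adoc)}\mathrm{data}(adoc(u))$ and named graphs $\langle u,\mathrm{data}(adoc(u))\rangle$ for $u\in U\cap\mathrm{dom}(adoc)$. For finite $S\subseteq\mathcal U$: $[\![\langle lpe,P\rangle]\!]^S_W=[\![P]\!]^{\mathfrak D}_G$ with $\mathfrak D=\mathrm{dataset}_W(\bigcup_{u\in S}[\![lpe]\!]^u_W)$ and $G$ its default graph; $[\![(\mathsf{SEED}\ U\ q)]\!]^S_W=[\![q]\!]^U_W$; $[\![(\mathsf{SEED}\ ?v\ q)]\!]^S_W=\bigcup_{u\in\mathcal U}([\![q]\!]^{\{u\}}_W\Join\{\{?v\mapsto u\}\})$; $\mathsf{UNION}$ is $\cup$; $\mathsf{AND}$ is $\Join$; $[\![\pi_Vq]\!]^S_W$ consists of the restrictions of the mappings in $[\![q]\!]^S_W$ to $V$. ($\mathsf{AND}$ is associative and commutative up to semantic equivalence, so parentheses are omitted.) For $u_c\in\mathrm{dom}(adoc)$: $[\![\varepsilon]\!]^{u_c}_W=\{u_c\}$; $[\![lp]\!]^{u_c}_W$ is the set of URIs $u$ such that some edge $\langle adoc(u_c),(t,u),d'\rangle\in\mathcal G_W$ matches $lp$ in the context of $u_c$; $[\![l_1/l_2]\!]^{u_c}_W=\bigcup_{u'\in[\![l_1]\!]^{u_c}_W}[\![l_2]\!]^{u'}_W$;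 $[\![l_1|l_2]\!]^{u_c}_W$ is the union; $[\![l^*]\!]^{u_c}_W=\{u_c\}\cup[\![l]\!]^{u_c}_W\cup[\![l/l]\!]^{u_c}_W\cup\cdots$; $[\![[l]]\!]^{u_c}_W=\{u_c\}$ if $[\![l]\!]^{u_c}_W\ne\emptyset$, else $\emptyset$; $[\![\langle ?v,q\rangle]\!]^{u_c}_W=\{u\in\mathcal U\mid\mu(?v)=u\text{ for some }\mu\in[\![q]\!]^{\{u_c\}}_W\}$. If $u_c\notin\mathrm{dom}(adoc)$ then $[\![lpe]\!]^{u_c}_W=\emptyset$. **Web-safeness.** An LDQL query $q$ is Web-safe if there exists an algorithm that, for any finite Web of Linked Data $W=\langle D,adoc\rangle$ and any finite set $S$ of URIs, computes $[\![q]\!]^S_W$ by looking up only a finite number of URIs, without assuming an a priori availability of any information about the sets $D$ and $\mathrm{dom}(adoc)$. (Looking up a URI $u$ retrieves the document $adoc(u)$ with its data if $u\in\mathrm{dom}(adoc)$, and reports failure otherwise; this is the algorithm's only access to $W$.) **Strongly bound variables.** For graph patterns: $\mathrm{sbvars}(B)=\mathrm{var}(B)$ for a basic graph pattern $B$; $\mathrm{sbvars}(P_1\,\mathsf{AND}\,P_2)=\mathrm{sbvars}(P_1)\cup\mathrm{sbvars}(P_2)$; $\mathrm{sbvars}(P_1\,\mathsf{UNION}\,P_2)=\mathrm{sbvars}(P_1)\cap\mathrm{sbvars}(P_2)$; $\mathrm{sbvars}$ of $(P_1\,\mathsf{OPT}\,P_2)$, $(P_1\,\mathsf{FILTER}\,R)$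 and $(P_1\,\mathsf{BIND}(e\,\mathsf{AS}\,?v))$ is $\mathrm{sbvars}(P_1)$; $\mathrm{sbvars}(\mathsf{GRAPH}\ c\ P_1)=\emptyset$. For LDQL queries: $\mathrm{sbvars}(\langle lpe,P\rangle)=\mathrm{sbvars}(P)$; $\mathrm{sbvars}(q_1\,\mathsf{AND}\,q_2)=\mathrm{sbvars}(q_1)\cup\mathrm{sbvars}(q_2)$; $\mathrm{sbvars}(q_1\,\mathsf{UNION}\,q_2)=\mathrm{sbvars}(q_1)\cap\mathrm{sbvars}(q_2)$; $\mathrm{sbvars}(\pi_Vq')=\mathrm{sbvars}(q')\cap V$; $\mathrm{sbvars}(\mathsf{SEED}\ U\ q')=\mathrm{sbvars}(q')$; $\mathrm{sbvars}(\mathsf{SEED}\ ?v\ q')=\mathrm{sbvars}(q')\cup\{?v\}$. *)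

theory Defs
  imports Complex_Main "HOL-Library.FSet" "HOL-Library.Countable_Set"
    "HOL-Library.Infinite_Typeclass"
begin

text \<open>
  The sets of URIs, blank nodes, literals, variables and documents are represented by
  type variables \<open>'u\<close>, \<open>'b\<close>, \<open>'l\<close>, \<open>'v\<close>, \<open>'d\<close>.
\<close>

datatype ('u, 'b, 'l) node = Uri 'u | Blank 'b | Lit 'l

type_synonym ('u, 'b, 'l) triple =
  "('u, 'b, 'l) node \<times> ('u, 'b, 'l) node \<times> ('u, 'b, 'l) node"

definition rdf_triples :: "('u, 'b, 'l) triple set" where
  "rdf_triples = (range Uri \<union> range Blank) \<times> range Uri \<times> UNIV"

fun uris :: "('u, 'b, 'l) triple \<Rightarrow> 'u set" where
  "uris (x, y, z) = {u. Uri u \<in> {x, y, z}}"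

fun blanks :: "('u, 'b, 'l) triple \<Rightarrow> 'b set" where
  "blanks (x, y, z) = {b. Blank b \<in> {x, y, z}}"

definition document_data :: "('d \<Rightarrow> ('u, 'b, 'l) triple set) \<Rightarrow> bool" where
  "document_data data \<longleftrightarrow>
     (\<forall>d. finite (data d) \<and> data d \<subseteq> rdf_triples) \<and>
     (\<forall>d d'. d \<noteq> d' \<longrightarrow> \<Union> (blanks ` data d) \<inter> \<Union> (blanks ` data d') = {})"

record ('u, 'd) web =
  docs :: "'d set"
  adoc :: "'u \<rightharpoonup> 'd"

definition is_web :: "('u, 'd) web \<Rightarrow> bool" where
  "is_web W \<longleftrightarrow> finite (docs W) \<and> ran (adoc W) = docs W"

definition link_graph ::
  "('d \<Rightarrow> ('u, 'b, 'l) triple set) \<Rightarrow> ('u, 'd) web \<Rightarrow> ('d \<times> (('u, 'b, 'l) triple \<times> 'u) \<times> 'd) set" where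
  "link_graph data W =
     {(d, (t, u), d'). d \<in> docs W \<and> t \<in> data d \<and> u \<in> uris t \<and> adoc W u = Some d'}"

type_synonym ('u, 'b, 'l, 'v) mapping = "'v \<rightharpoonup> ('u, 'b, 'l) node"

definition compatible :: "('u, 'b, 'l, 'v) mapping \<Rightarrow> ('u, 'b, 'l, 'v) mapping \<Rightarrow> bool" where
  "compatible \<mu> \<mu>' \<longleftrightarrow> (\<forall>x \<in> dom \<mu> \<inter> dom \<mu>'. \<mu> x = \<mu>' x)"

definition join ::
  "('u, 'b, 'l, 'v) mapping set \<Rightarrow> ('u, 'b, 'l, 'v) mapping set \<Rightarrow> ('u, 'b, 'l, 'v) mapping set" where
  "join \<Omega>\<^sub>1 \<Omega>\<^sub>2 = {\<mu>\<^sub>1 ++ \<mu>\<^sub>2 | \<mu>\<^sub>1 \<mu>\<^sub>2. \<mu>\<^sub>1 \<in> \<Omega>\<^sub>1 \<and> \<mu>\<^sub>2 \<in> \<Omega>\<^sub>2 \<and> compatible \<mu>\<^sub>1 \<mu>\<^sub>2}"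

record ('u, 'b, 'l) dataset =
  default_graph :: "('u, 'b, 'l) triple set"
  named_graphs :: "'u \<rightharpoonup> ('u, 'b, 'l) triple set"

datatype ('u, 'l) const = CUri 'u | CLit 'l

fun const_node :: "('u, 'l) const \<Rightarrow> ('u, 'b, 'l) node" where
  "const_node (CUri u) = Uri u"
| "const_node (CLit l) = Lit l"

datatype ('c, 'v) pterm = Con 'c | Var 'v

type_synonym ('u, 'l, 'v) triple_pattern =
  "(('u, 'l) const, 'v) pterm \<times> ('u, 'v) pterm \<times> (('u, 'l) const, 'v) pterm"

datatype ('u, 'l, 'v) filter_cond =
    Bound 'v
  | EqConst 'v "('u, 'l) const"
  | EqVar 'v 'v
  | FNot "('u, 'l, 'v) filter_cond"
  | FAnd "('u, 'l, 'v) filter_cond" "('u, 'l, 'v) filter_cond"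
  | FOr "('u, 'l, 'v) filter_cond" "('u, 'l, 'v) filter_cond"

datatype ('u, 'l, 'v) pattern =
    BGP "('u, 'l, 'v) triple_pattern fset"
  | PAnd "('u, 'l, 'v) pattern" "('u, 'l, 'v) pattern"
  | PUnion "('u, 'l, 'v) pattern" "('u, 'l, 'v) pattern"
  | POpt "('u, 'l, 'v) pattern" "('u, 'l, 'v) pattern"
  | PFilter "('u, 'l, 'v) pattern" "('u, 'l, 'v) filter_cond"
  | PGraph "('u, 'v) pterm" "('u, 'l, 'v) pattern"
  | PBind "('u, 'l, 'v) pattern" "(('u, 'l) const, 'v) pterm" 'v

fun term_vars :: "('c, 'v) pterm \<Rightarrow> 'v set" where
  "term_vars (Con c) = {}"
| "term_vars (Var v) = {v}"

fun tp_vars :: "('u, 'l, 'v) triple_pattern \<Rightarrow> 'v set" where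
  "tp_vars (x, y, z) = term_vars x \<union> term_vars y \<union> term_vars z"

definition bgp_vars :: "('u, 'l, 'v) triple_pattern fset \<Rightarrow> 'v set" where
  "bgp_vars B = \<Union> (tp_vars ` fset B)"

primrec filter_vars :: "('u, 'l, 'v) filter_cond \<Rightarrow> 'v set" where
  "filter_vars (Bound x) = {x}"
| "filter_vars (EqConst x c) = {x}"
| "filter_vars (EqVar x y) = {x, y}"
| "filter_vars (FNot R) = filter_vars R"
| "filter_vars (FAnd R\<^sub>1 R\<^sub>2) = filter_vars R\<^sub>1 \<union> filter_vars R\<^sub>2"
| "filter_vars (FOr R\<^sub>1 R\<^sub>2) = filter_vars R\<^sub>1 \<union> filter_vars R\<^sub>2"

primrec pattern_vars :: "('u, 'l, 'v) pattern \<Rightarrow> 'v set" where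
  "pattern_vars (BGP B) = bgp_vars B"
| "pattern_vars (PAnd P\<^sub>1 P\<^sub>2) = pattern_vars P\<^sub>1 \<union> pattern_vars P\<^sub>2"
| "pattern_vars (PUnion P\<^sub>1 P\<^sub>2) = pattern_vars P\<^sub>1 \<union> pattern_vars P\<^sub>2"
| "pattern_vars (POpt P\<^sub>1 P\<^sub>2) = pattern_vars P\<^sub>1 \<union> pattern_vars P\<^sub>2"
| "pattern_vars (PFilter P R) = pattern_vars P \<union> filter_vars R"
| "pattern_vars (PGraph c P) = term_vars c \<union> pattern_vars P"
| "pattern_vars (PBind P e v) = pattern_vars P \<union> term_vars e \<union> {v}"

primrec wf_pattern :: "('u, 'l, 'v) pattern \<Rightarrow> bool" where
  "wf_pattern (BGP B) \<longleftrightarrow> True"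
| "wf_pattern (PAnd P\<^sub>1 P\<^sub>2) \<longleftrightarrow> wf_pattern P\<^sub>1 \<and> wf_pattern P\<^sub>2"
| "wf_pattern (PUnion P\<^sub>1 P\<^sub>2) \<longleftrightarrow> wf_pattern P\<^sub>1 \<and> wf_pattern P\<^sub>2"
| "wf_pattern (POpt P\<^sub>1 P\<^sub>2) \<longleftrightarrow> wf_pattern P\<^sub>1 \<and> wf_pattern P\<^sub>2"
| "wf_pattern (PFilter P R) \<longleftrightarrow> wf_pattern P"
| "wf_pattern (PGraph c P) \<longleftrightarrow> wf_pattern P"
| "wf_pattern (PBind P e v) \<longleftrightarrow> wf_pattern P \<and> v \<notin> pattern_vars P"

text \<open>
  Substitution \<open>\<mu>[\<alpha>]\<close>, with \<open>None\<close> if \<open>\<alpha>\<close> is a variable outside \<open>dom \<mu>\<close>, so that \<open>\<mu>[\<alpha>]\<close> is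
  not an RDF node. The argument \<open>f\<close> embeds the constants into the nodes.
\<close>

fun inst :: "('c \<Rightarrow> ('u, 'b, 'l) node) \<Rightarrow> ('u, 'b, 'l, 'v) mapping \<Rightarrow> ('c, 'v) pterm
    \<Rightarrow> ('u, 'b, 'l) node option" where
  "inst f \<mu> (Con c) = Some (f c)"
| "inst f \<mu> (Var v) = \<mu> v"

fun tp_in :: "('u, 'b, 'l, 'v) mapping \<Rightarrow> ('u, 'l, 'v) triple_pattern
    \<Rightarrow> ('u, 'b, 'l) triple set \<Rightarrow> bool" where
  "tp_in \<mu> (x, y, z) G \<longleftrightarrow> (\<exists>(a, b, c) \<in> G.
     inst const_node \<mu> x = Some a \<and> inst Uri \<mu> y = Some b \<and> inst const_node \<mu> z = Some c)"

primrec sat :: "('u, 'b, 'l, 'v) mapping \<Rightarrow> ('u, 'l, 'v) filter_cond \<Rightarrow> bool" where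
  "sat \<mu> (Bound x) \<longleftrightarrow> x \<in> dom \<mu>"
| "sat \<mu> (EqConst x c) \<longleftrightarrow> \<mu> x = Some (const_node c)"
| "sat \<mu> (EqVar x y) \<longleftrightarrow> x \<in> dom \<mu> \<and> y \<in> dom \<mu> \<and> \<mu> x = \<mu> y"
| "sat \<mu> (FNot R) \<longleftrightarrow> \<not> sat \<mu> R"
| "sat \<mu> (FAnd R\<^sub>1 R\<^sub>2) \<longleftrightarrow> sat \<mu> R\<^sub>1 \<and> sat \<mu> R\<^sub>2"
| "sat \<mu> (FOr R\<^sub>1 R\<^sub>2) \<longleftrightarrow> sat \<mu> R\<^sub>1 \<or> sat \<mu> R\<^sub>2"

primrec peval :: "('u, 'b, 'l) dataset \<Rightarrow> ('u, 'l, 'v) pattern \<Rightarrow> ('u, 'b, 'l) triple set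
    \<Rightarrow> ('u, 'b, 'l, 'v) mapping set" where
  "peval \<DD> (BGP B) G = {\<mu>. dom \<mu> = bgp_vars B \<and> (\<forall>tp \<in> fset B. tp_in \<mu> tp G)}"
| "peval \<DD> (PAnd P\<^sub>1 P\<^sub>2) G = join (peval \<DD> P\<^sub>1 G) (peval \<DD> P\<^sub>2 G)"
| "peval \<DD> (PUnion P\<^sub>1 P\<^sub>2) G = peval \<DD> P\<^sub>1 G \<union> peval \<DD> P\<^sub>2 G"
| "peval \<DD> (POpt P\<^sub>1 P\<^sub>2) G = join (peval \<DD> P\<^sub>1 G) (peval \<DD> P\<^sub>2 G) \<union>
     {\<mu> \<in> peval \<DD> P\<^sub>1 G. \<not> (\<exists>\<mu>' \<in> peval \<DD> P\<^sub>2 G. compatible \<mu> \<mu>')}"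
| "peval \<DD> (PFilter P R) G = {\<mu> \<in> peval \<DD> P G. sat \<mu> R}"
| "peval \<DD> (PGraph c P) G = (case c of
      Con u \<Rightarrow> peval \<DD> P (case named_graphs \<DD> u of None \<Rightarrow> {} | Some G' \<Rightarrow> G')
    | Var x \<Rightarrow> (\<Union>u \<in> dom (named_graphs \<DD>).
        join (peval \<DD> P (the (named_graphs \<DD> u))) {[x \<mapsto> Uri u]}))"
| "peval \<DD> (PBind P e v) G = (\<lambda>\<mu>. case inst const_node \<mu> e of
      None \<Rightarrow> \<mu> | Some a \<Rightarrow> \<mu>(v \<mapsto> a)) ` peval \<DD> P G"

primrec pattern_sbvars :: "('u, 'l, 'v) pattern \<Rightarrow> 'v set" where
  "pattern_sbvars (BGP B) = bgp_vars B"
| "pattern_sbvars (PAnd P\<^sub>1 P\<^sub>2) = pattern_sbvars P\<^sub>1 \<union> pattern_sbvars P\<^sub>2"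
| "pattern_sbvars (PUnion P\<^sub>1 P\<^sub>2) = pattern_sbvars P\<^sub>1 \<inter> pattern_sbvars P\<^sub>2"
| "pattern_sbvars (POpt P\<^sub>1 P\<^sub>2) = pattern_sbvars P\<^sub>1"
| "pattern_sbvars (PFilter P R) = pattern_sbvars P"
| "pattern_sbvars (PGraph c P) = {}"
| "pattern_sbvars (PBind P e v) = pattern_sbvars P"

text \<open>\<open>Wild\<close> is the symbol \<open>_\<close> and \<open>Ctx\<close> is the symbol \<open>+\<close>.\<close>

datatype 'a slot = Wild | Ctx | Fix 'a

type_synonym ('u, 'l) link_pattern = "'u slot \<times> 'u slot \<times> ('u, 'l) const slot"

fun slot_ok :: "('a \<Rightarrow> ('u, 'b, 'l) node) \<Rightarrow> 'u \<Rightarrow> 'a slot \<Rightarrow> ('u, 'b, 'l) node \<Rightarrow> bool" where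
  "slot_ok f u\<^sub>c Wild x \<longleftrightarrow> True"
| "slot_ok f u\<^sub>c Ctx x \<longleftrightarrow> x = Uri u\<^sub>c"
| "slot_ok f u\<^sub>c (Fix a) x \<longleftrightarrow> x = f a"

fun matches :: "('u, 'b, 'l) triple \<times> 'u \<Rightarrow> ('u, 'l) link_pattern \<Rightarrow> 'u \<Rightarrow> bool" where
  "matches ((x\<^sub>1, x\<^sub>2, x\<^sub>3), u) (y\<^sub>1, y\<^sub>2, y\<^sub>3) u\<^sub>c \<longleftrightarrow>
     (y\<^sub>1 = Wild \<and> x\<^sub>1 = Uri u \<or> y\<^sub>2 = Wild \<and> x\<^sub>2 = Uri u \<or> y\<^sub>3 = Wild \<and> x\<^sub>3 = Uri u) \<and>
     slot_ok Uri u\<^sub>c y\<^sub>1 x\<^sub>1 \<and> slot_ok Uri u\<^sub>c y\<^sub>2 x\<^sub>2 \<and> slot_ok const_node u\<^sub>c y\<^sub>3 x\<^sub>3"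

datatype ('u, 'l, 'v) query =
    Basic "('u, 'l, 'v) lpe" "('u, 'l, 'v) pattern"
  | SeedUris "'u fset" "('u, 'l, 'v) query"
  | SeedVar 'v "('u, 'l, 'v) query"
  | QAnd "('u, 'l, 'v) query" "('u, 'l, 'v) query"
  | QUnion "('u, 'l, 'v) query" "('u, 'l, 'v) query"
  | Project "'v fset" "('u, 'l, 'v) query"
and ('u, 'l, 'v) lpe =
    Eps
  | Link "('u, 'l) link_pattern"
  | Path "('u, 'l, 'v) lpe" "('u, 'l, 'v) lpe"
  | Alt "('u, 'l, 'v) lpe" "('u, 'l, 'v) lpe"
  | Star "('u, 'l, 'v) lpe"
  | Test "('u, 'l, 'v) lpe"
  | Sub 'v "('u, 'l, 'v) query"

primrec wf_query :: "('u, 'l, 'v) query \<Rightarrow> bool"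
  and wf_lpe :: "('u, 'l, 'v) lpe \<Rightarrow> bool" where
  "wf_query (Basic l P) \<longleftrightarrow> wf_lpe l \<and> wf_pattern P"
| "wf_query (SeedUris U q) \<longleftrightarrow> wf_query q"
| "wf_query (SeedVar v q) \<longleftrightarrow> wf_query q"
| "wf_query (QAnd q\<^sub>1 q\<^sub>2) \<longleftrightarrow> wf_query q\<^sub>1 \<and> wf_query q\<^sub>2"
| "wf_query (QUnion q\<^sub>1 q\<^sub>2) \<longleftrightarrow> wf_query q\<^sub>1 \<and> wf_query q\<^sub>2"
| "wf_query (Project V q) \<longleftrightarrow> wf_query q"
| "wf_lpe Eps \<longleftrightarrow> True"
| "wf_lpe (Link lp) \<longleftrightarrow> True"
| "wf_lpe (Path l\<^sub>1 l\<^sub>2) \<longleftrightarrow> wf_lpe l\<^sub>1 \<and> wf_lpe l\<^sub>2"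
| "wf_lpe (Alt l\<^sub>1 l\<^sub>2) \<longleftrightarrow> wf_lpe l\<^sub>1 \<and> wf_lpe l\<^sub>2"
| "wf_lpe (Star l) \<longleftrightarrow> wf_lpe l"
| "wf_lpe (Test l) \<longleftrightarrow> wf_lpe l"
| "wf_lpe (Sub v q) \<longleftrightarrow> wf_query q"

definition web_dataset ::
  "('d \<Rightarrow> ('u, 'b, 'l) triple set) \<Rightarrow> ('u, 'd) web \<Rightarrow> 'u set \<Rightarrow> ('u, 'b, 'l) dataset" where
  "web_dataset data W U =
     \<lparr> default_graph = (\<Union>u \<in> U \<inter> dom (adoc W). data (the (adoc W u))),
       named_graphs = (\<lambda>u. if u \<in> U then map_option data (adoc W u) else None) \<rparr>"

primrec qeval :: "('d \<Rightarrow> ('u, 'b, 'l) triple set) \<Rightarrow> ('u, 'd) web \<Rightarrow> ('u, 'l, 'v) query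
    \<Rightarrow> 'u set \<Rightarrow> ('u, 'b, 'l, 'v) mapping set"
  and lpe_eval :: "('d \<Rightarrow> ('u, 'b, 'l) triple set) \<Rightarrow> ('u, 'd) web \<Rightarrow> ('u, 'l, 'v) lpe
    \<Rightarrow> 'u \<Rightarrow> 'u set" where
  "qeval data W (Basic l P) S =
     (let \<DD> = web_dataset data W (\<Union>u \<in> S. lpe_eval data W l u)
      in peval \<DD> P (default_graph \<DD>))"
| "qeval data W (SeedUris U q) S = qeval data W q (fset U)"
| "qeval data W (SeedVar v q) S = (\<Union>u. join (qeval data W q {u}) {[v \<mapsto> Uri u]})"
| "qeval data W (QAnd q\<^sub>1 q\<^sub>2) S = join (qeval data W q\<^sub>1 S) (qeval data W q\<^sub>2 S)"
| "qeval data W (QUnion q\<^sub>1 q\<^sub>2) S = qeval data W q\<^sub>1 S \<union> qeval data W q\<^sub>2 S"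
| "qeval data W (Project V q) S = (\<lambda>\<mu>. \<mu> |` fset V) ` qeval data W q S"
| "lpe_eval data W Eps u\<^sub>c = (if u\<^sub>c \<in> dom (adoc W) then {u\<^sub>c} else {})"
| "lpe_eval data W (Link lp) u\<^sub>c = (if u\<^sub>c \<in> dom (adoc W) then
     {u. \<exists>t d'. (the (adoc W u\<^sub>c), (t, u), d') \<in> link_graph data W \<and> matches (t, u) lp u\<^sub>c}
   else {})"
| "lpe_eval data W (Path l\<^sub>1 l\<^sub>2) u\<^sub>c = (if u\<^sub>c \<in> dom (adoc W) then
     (\<Union>u' \<in> lpe_eval data W l\<^sub>1 u\<^sub>c. lpe_eval data W l\<^sub>2 u')
   else {})"
| "lpe_eval data W (Alt l\<^sub>1 l\<^sub>2) u\<^sub>c = (if u\<^sub>c \<in> dom (adoc W) then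
     lpe_eval data W l\<^sub>1 u\<^sub>c \<union> lpe_eval data W l\<^sub>2 u\<^sub>c
   else {})"
| "lpe_eval data W (Star l) u\<^sub>c = (if u\<^sub>c \<in> dom (adoc W) then
     (\<Union>n. ({(u, u'). u' \<in> lpe_eval data W l u} ^^ n) `` {u\<^sub>c})
   else {})"
| "lpe_eval data W (Test l) u\<^sub>c = (if u\<^sub>c \<in> dom (adoc W) then
     (if lpe_eval data W l u\<^sub>c \<noteq> {} then {u\<^sub>c} else {})
   else {})"
| "lpe_eval data W (Sub v q) u\<^sub>c = (if u\<^sub>c \<in> dom (adoc W) then
     {u. \<exists>\<mu> \<in> qeval data W q {u\<^sub>c}. \<mu> v = Some (Uri u)}
   else {})"

primrec sbvars :: "('u, 'l, 'v) query \<Rightarrow> 'v set" where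
  "sbvars (Basic l P) = pattern_sbvars P"
| "sbvars (SeedUris U q) = sbvars q"
| "sbvars (SeedVar v q) = sbvars q \<union> {v}"
| "sbvars (QAnd q\<^sub>1 q\<^sub>2) = sbvars q\<^sub>1 \<union> sbvars q\<^sub>2"
| "sbvars (QUnion q\<^sub>1 q\<^sub>2) = sbvars q\<^sub>1 \<inter> sbvars q\<^sub>2"
| "sbvars (Project V q) = sbvars q \<inter> fset V"

text \<open>
  \<open>conjunction Q qs\<close>: the query \<open>Q\<close> is \<open>q\<^sub>1 AND \<dots> AND q\<^sub>m\<close> for the nonempty list
  \<open>qs = [q\<^sub>1, \<dots>, q\<^sub>m]\<close>, with the omitted parentheses placed in any way.
\<close>

inductive conjunction :: "('u, 'l, 'v) query \<Rightarrow> ('u, 'l, 'v) query list \<Rightarrow> bool" where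
  "conjunction q [q]"
| "conjunction Q\<^sub>1 qs\<^sub>1 \<Longrightarrow> conjunction Q\<^sub>2 qs\<^sub>2 \<Longrightarrow> conjunction (QAnd Q\<^sub>1 Q\<^sub>2) (qs\<^sub>1 @ qs\<^sub>2)"

text \<open>
  Algorithms are programs of a Turing-complete language over binary trees: Jones' WHILE language
  in variable-free form, where the store is the single tree passed from one program to the next,
  extended by the instruction \<open>Lookup\<close>. The tree \<open>Leaf\<close> is also the truth value false.
\<close>

datatype tree = Leaf | Node tree tree

fun left :: "tree \<Rightarrow> tree" where
  "left Leaf = Leaf"
| "left (Node a b) = a"

fun right :: "tree \<Rightarrow> tree" where
  "right Leaf = Leaf"
| "right (Node a b) = b"

datatype prog =
    Ident
  | Empty
  | Left
  | Right
  | Equal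
  | Lookup
  | Both prog prog
  | Then prog prog
  | Cond prog prog prog
  | Loop prog prog

text \<open>
  \<open>run ans p x L y\<close>: when lookups are answered by \<open>ans\<close>, the program \<open>p\<close> terminates on input \<open>x\<close>
  with output \<open>y\<close>, and \<open>L\<close> is the set of all trees it looks up on the way.
\<close>

inductive run :: "(tree \<Rightarrow> tree) \<Rightarrow> prog \<Rightarrow> tree \<Rightarrow> tree set \<Rightarrow> tree \<Rightarrow> bool"
  for ans :: "tree \<Rightarrow> tree" where
  Ident: "run ans Ident x {} x"
| Empty: "run ans Empty x {} Leaf"
| Left: "run ans Left x {} (left x)"
| Right: "run ans Right x {} (right x)"
| Equal: "run ans Equal x {} (if left x = right x then Node Leaf Leaf else Leaf)"
| Lookup: "run ans Lookup x {x} (ans x)"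
| Both: "run ans p x L y \<Longrightarrow> run ans q x M z \<Longrightarrow> run ans (Both p q) x (L \<union> M) (Node y z)"
| Then: "run ans p x L y \<Longrightarrow> run ans q y M z \<Longrightarrow> run ans (Then p q) x (L \<union> M) z"
| Cond_true: "run ans c x L b \<Longrightarrow> b \<noteq> Leaf \<Longrightarrow> run ans p x M y
    \<Longrightarrow> run ans (Cond c p q) x (L \<union> M) y"
| Cond_false: "run ans c x L Leaf \<Longrightarrow> run ans q x M y \<Longrightarrow> run ans (Cond c p q) x (L \<union> M) y"
| Loop_step: "run ans c x L b \<Longrightarrow> b \<noteq> Leaf \<Longrightarrow> run ans p x M y \<Longrightarrow> run ans (Loop c p) y N z
    \<Longrightarrow> run ans (Loop c p) x (L \<union> M \<union> N) z"
| Loop_end: "run ans c x L Leaf \<Longrightarrow> run ans (Loop c p) x L x"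

primrec nat_tree :: "nat \<Rightarrow> tree" where
  "nat_tree 0 = Leaf"
| "nat_tree (Suc n) = Node Leaf (nat_tree n)"

primrec list_tree :: "tree list \<Rightarrow> tree" where
  "list_tree [] = Leaf"
| "list_tree (x # xs) = Node x (list_tree xs)"

text \<open>On a countably infinite type, \<open>to_nat_on UNIV\<close> is a bijection onto the natural numbers.\<close>

definition code :: "'a::{countable, infinite} \<Rightarrow> tree" where
  "code x = nat_tree (to_nat_on UNIV x)"

fun node_tree ::
  "('u::{countable, infinite}, 'b::{countable, infinite}, 'l::{countable, infinite}) node \<Rightarrow> tree" where
  "node_tree (Uri u) = Node (nat_tree 0) (code u)"
| "node_tree (Blank b) = Node (nat_tree 1) (code b)"
| "node_tree (Lit l) = Node (nat_tree 2) (code l)"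

fun triple_tree ::
  "('u::{countable, infinite}, 'b::{countable, infinite}, 'l::{countable, infinite}) triple \<Rightarrow> tree" where
  "triple_tree (x, y, z) = Node (node_tree x) (Node (node_tree y) (node_tree z))"

fun binding_tree ::
  "'v::{countable, infinite} \<times>
   ('u::{countable, infinite}, 'b::{countable, infinite}, 'l::{countable, infinite}) node \<Rightarrow> tree" where
  "binding_tree (v, x) = Node (code v) (node_tree x)"

text \<open>
  Finite sets are represented by arbitrary listings of their elements, possibly with repetitions.
  A mapping is represented as the set of its bindings. In particular, only finite results can be
  output.
\<close>

definition represents_uris :: "tree \<Rightarrow> 'u::{countable, infinite} set \<Rightarrow> bool" where
  "represents_uris t S \<longleftrightarrow> (\<exists>us. t = list_tree (map code us) \<and> set us = S)"

definition represents_triples :: "tree \<Rightarrow>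
    ('u::{countable, infinite}, 'b::{countable, infinite}, 'l::{countable, infinite}) triple set
    \<Rightarrow> bool" where
  "represents_triples t G \<longleftrightarrow> (\<exists>ts. t = list_tree (map triple_tree ts) \<and> set ts = G)"

definition represents_mapping :: "tree \<Rightarrow>
    ('u::{countable, infinite}, 'b::{countable, infinite}, 'l::{countable, infinite},
     'v::{countable, infinite}) mapping \<Rightarrow> bool" where
  "represents_mapping t \<mu> \<longleftrightarrow>
     (\<exists>bs. t = list_tree (map binding_tree bs) \<and> set bs = Map.graph \<mu>)"

definition represents_result :: "tree \<Rightarrow>
    ('u::{countable, infinite}, 'b::{countable, infinite}, 'l::{countable, infinite},
     'v::{countable, infinite}) mapping set \<Rightarrow> bool" where
  "represents_result t \<Omega> \<longleftrightarrow>
     (\<exists>ts \<mu>s. t = list_tree ts \<and> list_all2 represents_mapping ts \<mu>s \<and> set \<mu>s = \<Omega>)"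

text \<open>
  \<open>answers data W ans\<close>: looking up the code of a URI \<open>u\<close> yields the document \<open>adoc u\<close> with a listing
  of its data if \<open>u\<close> is in the domain of \<open>adoc\<close>; every other lookup fails with \<open>Leaf\<close>.
\<close>

definition answers ::
  "('d::{countable, infinite} \<Rightarrow>
     ('u::{countable, infinite}, 'b::{countable, infinite}, 'l::{countable, infinite}) triple set)
   \<Rightarrow> ('u, 'd) web \<Rightarrow> (tree \<Rightarrow> tree) \<Rightarrow> bool" where
  "answers data W ans \<longleftrightarrow>
     (\<forall>u d. adoc W u = Some d \<longrightarrow>
        (\<exists>t. represents_triples t (data d) \<and> ans (code u) = Node (code d) t)) \<and>
     (\<forall>x. x \<notin> code ` dom (adoc W) \<longrightarrow> ans x = Leaf)"

definition web_safe ::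
  "('d::{countable, infinite} \<Rightarrow>
     ('u::{countable, infinite}, 'b::{countable, infinite}, 'l::{countable, infinite}) triple set)
   \<Rightarrow> ('u, 'l, 'v::{countable, infinite}) query \<Rightarrow> bool" where
  "web_safe data q \<longleftrightarrow>
     (\<exists>p. \<forall>W S ans x. is_web W \<longrightarrow> finite S \<longrightarrow> answers data W ans \<longrightarrow> represents_uris x S \<longrightarrow>
        (\<exists>L y. run ans p x L y \<and> finite L \<and> represents_result y (qeval data W q S)))"

end

theory Submission
  imports Defs "HOL-Library.Multiset"
begin

text \<open>
  Join is associative and commutative with unit \<open>{\<emptyset>}\<close>, so the conjuncts may be processed in
  the given order, repetitions included. Every solution of the conjuncts processed so far binds
  their strongly bound variables. Hence a conjunct \<open>SEED ?v q\<close> of the second kind need not be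
  evaluated for all URIs: a solution \<open>\<mu>\<close> found so far only joins with solutions of \<open>q\<close> seeded
  at \<open>\<mu>(?v)\<close>, and with none if \<open>\<mu>(?v)\<close> is not a URI.
\<close>

section \<open>Joins and strongly bound variables\<close>

text \<open>\<open>SEED ?v q\<close> ranges over infinitely many URIs, whereas a program may look up
  only finitely many. Finiteness comes from the definition of Web-safeness itself: a result is
  output as a list, so only finitely many mappings have to be extended. The programs of the
  conjuncts are obtained before the Web, the seeds and the answers are known. They are black boxes,
  and everything built around them works on trees without any lookup. As a list may contain its
  entries in any order and repeatedly, loops are described by the set of entries read so far. The
  order on the subqueries enters only at the end, where counting predecessors turns it into a key
  for sorting.\<close>

lemma join_iff:
  "\<mu> \<in> join A B \<longleftrightarrow> (\<exists>\<mu>\<^sub>1\<in>A. \<exists>\<mu>\<^sub>2\<in>B. compatible \<mu>\<^sub>1 \<mu>\<^sub>2 \<and> \<mu> = \<mu>\<^sub>1 ++ \<mu>\<^sub>2)"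
  unfolding join_def by blast

lemma dom_join:
  assumes "\<mu> \<in> join A B" "\<And>\<nu>. \<nu> \<in> A \<Longrightarrow> V \<subseteq> dom \<nu>" "\<And>\<nu>. \<nu> \<in> B \<Longrightarrow> V' \<subseteq> dom \<nu>"
  shows "V \<union> V' \<subseteq> dom \<mu>"
proof -
  obtain \<mu>\<^sub>1 \<mu>\<^sub>2 where *: "\<mu>\<^sub>1 \<in> A" "\<mu>\<^sub>2 \<in> B" "\<mu> = \<mu>\<^sub>1 ++ \<mu>\<^sub>2"
    using assms(1) unfolding join_iff by blast
  show ?thesis
    unfolding *(3) dom_map_add using assms(2)[OF *(1)] assms(3)[OF *(2)] by blast
qed

lemma join_singletons: "join {\<mu>} {\<nu>} = (if compatible \<mu> \<nu> then {\<mu> ++ \<nu>} else {})"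
  by (auto simp: join_def)

lemma compatible_iff:
  "compatible \<mu> \<nu> \<longleftrightarrow> (\<forall>x a b. \<mu> x = Some a \<longrightarrow> \<nu> x = Some b \<longrightarrow> a = b)"
proof -
  have "(x \<in> dom \<mu> \<inter> dom \<nu> \<longrightarrow> \<mu> x = \<nu> x) \<longleftrightarrow>
      (\<forall>a b. \<mu> x = Some a \<longrightarrow> \<nu> x = Some b \<longrightarrow> a = b)" for x
    by (cases "\<mu> x"; cases "\<nu> x") (simp_all add: domIff)
  then show ?thesis
    unfolding compatible_def Ball_def by simp
qed

lemma compatible_sym: "compatible \<mu> \<nu> \<Longrightarrow> compatible \<nu> \<mu>"
  unfolding compatible_iff by blast

lemma compatible_add_commute: "compatible \<mu> \<nu> \<Longrightarrow> \<mu> ++ \<nu> = \<nu> ++ \<mu>"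
proof (rule ext)
  show "(\<mu> ++ \<nu>) x = (\<nu> ++ \<mu>) x" if "compatible \<mu> \<nu>" for x
    using that by (cases "\<mu> x"; cases "\<nu> x") (auto simp: compatible_iff map_add_def)
qed

text \<open>Both sides amount to pairwise compatibility of the three mappings, which can be decided
  at each variable separately.\<close>

lemma compatible_add_assoc:
  "compatible \<mu> \<nu> \<and> compatible (\<mu> ++ \<nu>) \<rho> \<longleftrightarrow> compatible \<nu> \<rho> \<and> compatible \<mu> (\<nu> ++ \<rho>)"
  unfolding compatible_iff all_conj_distrib[symmetric]
proof (rule iff_allI)
  show "(\<forall>a b. (\<mu> x = Some a \<longrightarrow> \<nu> x = Some b \<longrightarrow> a = b) \<and>
        ((\<mu> ++ \<nu>) x = Some a \<longrightarrow> \<rho> x = Some b \<longrightarrow> a = b)) \<longleftrightarrow>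
      (\<forall>a b. (\<nu> x = Some a \<longrightarrow> \<rho> x = Some b \<longrightarrow> a = b) \<and>
        (\<mu> x = Some a \<longrightarrow> (\<nu> ++ \<rho>) x = Some b \<longrightarrow> a = b))" for x
    by (cases "\<mu> x"; cases "\<nu> x"; cases "\<rho> x") (auto simp: map_add_def)
qed

lemma join_commute_subset: "join A B \<subseteq> join B A"
proof
  fix \<mu>
  assume "\<mu> \<in> join A B"
  then obtain \<mu>\<^sub>1 \<mu>\<^sub>2 where *: "\<mu>\<^sub>1 \<in> A" "\<mu>\<^sub>2 \<in> B" "compatible \<mu>\<^sub>1 \<mu>\<^sub>2" "\<mu> = \<mu>\<^sub>1 ++ \<mu>\<^sub>2"
    unfolding join_iff by blast
  have "compatible \<mu>\<^sub>2 \<mu>\<^sub>1" "\<mu> = \<mu>\<^sub>2 ++ \<mu>\<^sub>1"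
    using *(4) compatible_sym[OF *(3)] compatible_add_commute[OF *(3)] by simp_all
  then show "\<mu> \<in> join B A"
    unfolding join_iff using *(1,2) by blast
qed

lemma join_commute: "join A B = join B A"
  by (rule subset_antisym[OF join_commute_subset join_commute_subset])

lemma bex_join:
  "(\<exists>\<mu>\<in>join A B. P \<mu>) \<longleftrightarrow> (\<exists>\<mu>\<^sub>1\<in>A. \<exists>\<mu>\<^sub>2\<in>B. compatible \<mu>\<^sub>1 \<mu>\<^sub>2 \<and> P (\<mu>\<^sub>1 ++ \<mu>\<^sub>2))"
  unfolding join_def by blast

lemma join_assoc: "join (join A B) C = join A (join B C)"
proof (rule set_eqI)
  fix \<mu>
  have "\<mu> \<in> join (join A B) C \<longleftrightarrow> (\<exists>\<mu>\<^sub>1\<in>A. \<exists>\<mu>\<^sub>2\<in>B. \<exists>\<mu>\<^sub>3\<in>C.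
      (compatible \<mu>\<^sub>1 \<mu>\<^sub>2 \<and> compatible (\<mu>\<^sub>1 ++ \<mu>\<^sub>2) \<mu>\<^sub>3) \<and> \<mu> = \<mu>\<^sub>1 ++ \<mu>\<^sub>2 ++ \<mu>\<^sub>3)"
    by (simp add: join_iff[of _ "join A B"] bex_join)
  also have "\<dots> \<longleftrightarrow> (\<exists>\<mu>\<^sub>1\<in>A. \<exists>\<mu>\<^sub>2\<in>B. \<exists>\<mu>\<^sub>3\<in>C.
      (compatible \<mu>\<^sub>2 \<mu>\<^sub>3 \<and> compatible \<mu>\<^sub>1 (\<mu>\<^sub>2 ++ \<mu>\<^sub>3)) \<and> \<mu> = \<mu>\<^sub>1 ++ (\<mu>\<^sub>2 ++ \<mu>\<^sub>3))"
    by (simp only: compatible_add_assoc map_add_assoc)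
  also have "\<dots> \<longleftrightarrow> \<mu> \<in> join A (join B C)"
    by (simp add: join_iff[of _ A] bex_join)
  finally show "\<mu> \<in> join (join A B) C \<longleftrightarrow> \<mu> \<in> join A (join B C)" .
qed

lemma join_unit [simp]: "join {Map.empty} A = A" "join A {Map.empty} = A"
  by (simp_all add: set_eq_iff join_iff compatible_iff)

lemma join_UN_left: "join A B = (\<Union>\<mu>\<in>A. join {\<mu>} B)"
  unfolding join_def by blast

lemma join_UN_right: "join A (\<Union>i\<in>I. B i) = (\<Union>i\<in>I. join A (B i))"
  unfolding join_def by blast

text \<open>Commutativity and associativity move the singleton next to \<open>\<mu>\<close>, which
  here absorbs it and in the next lemma contradicts it.\<close>

lemma join_seed:
  assumes "\<mu> v = Some (Uri u)"
  shows "join {\<mu>} (join A {[v \<mapsto> Uri u]}) = join {\<mu>} A"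
proof -
  have "join {\<mu>} {[v \<mapsto> Uri u]} = {\<mu>}"
    using assms by (auto simp: join_singletons compatible_iff fun_eq_iff map_add_def split: if_splits)
  then show ?thesis
    by (simp add: join_commute[of A] flip: join_assoc)
qed

lemma join_seed_mismatch:
  assumes "\<mu> v = Some a" "a \<noteq> Uri u"
  shows "join {\<mu>} (join A {[v \<mapsto> Uri u]}) = {}"
proof -
  have "join {\<mu>} {[v \<mapsto> Uri u]} = {}"
    using assms by (auto simp: join_singletons compatible_iff)
  then show ?thesis
    by (simp add: join_commute[of A] flip: join_assoc) (simp add: join_def)
qed

lemma pattern_sbvars_dom: "\<mu> \<in> peval \<DD> P G \<Longrightarrow> pattern_sbvars P \<subseteq> dom \<mu>"
proof (induction P arbitrary: \<mu> G)
  case (PAnd P\<^sub>1 P\<^sub>2)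
  have "\<mu> \<in> join (peval \<DD> P\<^sub>1 G) (peval \<DD> P\<^sub>2 G)"
    using PAnd.prems by simp
  then show ?case
    unfolding pattern_sbvars.simps using PAnd.IH by (rule dom_join)
next
  case (PUnion P\<^sub>1 P\<^sub>2)
  have "\<mu> \<in> peval \<DD> P\<^sub>1 G \<or> \<mu> \<in> peval \<DD> P\<^sub>2 G"
    using PUnion.prems by simp
  then have "pattern_sbvars P\<^sub>1 \<subseteq> dom \<mu> \<or> pattern_sbvars P\<^sub>2 \<subseteq> dom \<mu>"
    using PUnion.IH by blast
  then show ?case
    unfolding pattern_sbvars.simps by blast
next
  case (POpt P\<^sub>1 P\<^sub>2)
  have "pattern_sbvars P\<^sub>1 \<union> {} \<subseteq> dom \<mu>" if "\<mu> \<in> join (peval \<DD> P\<^sub>1 G) (peval \<DD> P\<^sub>2 G)"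
    using that POpt.IH(1) by (rule dom_join) auto
  then show ?case
    using POpt.prems POpt.IH(1) by fastforce
next
  case (PBind P e v)
  then obtain \<nu> where \<nu>: "\<nu> \<in> peval \<DD> P G"
    and \<mu>: "\<mu> = (case inst const_node \<nu> e of None \<Rightarrow> \<nu> | Some a \<Rightarrow> \<nu>(v \<mapsto> a))"
    by auto
  have "dom \<nu> \<subseteq> dom \<mu>"
    unfolding \<mu> by (auto split: option.split)
  then show ?case
    using PBind.IH[OF \<nu>] by auto
qed auto

lemma sbvars_dom: "\<mu> \<in> qeval data W q S \<Longrightarrow> sbvars q \<subseteq> dom \<mu>"
\<comment> \<open>The induction is mutual with link path expressions. These affect a solution only
  through the dataset, and \<open>pattern_sbvars_dom\<close> holds for every dataset, so their
  predicate is trivial.\<close>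
proof (induction q arbitrary: \<mu> S rule: query.induct[where ?P2.0 = "\<lambda>_. True"])
  case (Basic l P)
  then show ?case
    using pattern_sbvars_dom by (simp add: Let_def)
next
  case (SeedVar v q)
  then obtain u where "\<mu> \<in> join (qeval data W q {u}) {[v \<mapsto> Uri u]}"
    by auto
  then have "sbvars q \<union> {v} \<subseteq> dom \<mu>"
    using SeedVar.IH by (rule dom_join) auto
  then show ?case
    by simp
next
  case (QAnd q\<^sub>1 q\<^sub>2)
  have "\<mu> \<in> join (qeval data W q\<^sub>1 S) (qeval data W q\<^sub>2 S)"
    using QAnd.prems by simp
  then show ?case
    unfolding sbvars.simps using QAnd.IH by (rule dom_join)
next
  case (QUnion q\<^sub>1 q\<^sub>2)
  have "\<mu> \<in> qeval data W q\<^sub>1 S \<or> \<mu> \<in> qeval data W q\<^sub>2 S"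
    using QUnion.prems by simp
  then have "sbvars q\<^sub>1 \<subseteq> dom \<mu> \<or> sbvars q\<^sub>2 \<subseteq> dom \<mu>"
    using QUnion.IH by blast
  then show ?case
    unfolding sbvars.simps by blast
next
  case (Project V q)
  then show ?case
    by fastforce
qed auto

section \<open>Conjunctions as folds of joins\<close>

abbreviation joins ::
  "('d \<Rightarrow> ('u, 'b, 'l) triple set) \<Rightarrow> ('u, 'd) web \<Rightarrow> ('u, 'l, 'v) query list \<Rightarrow> 'u set
    \<Rightarrow> ('u, 'b, 'l, 'v) mapping set" where
  "joins data W qs S \<equiv> fold (\<lambda>q \<Omega>. join \<Omega> (qeval data W q S)) qs {Map.empty}"

text \<open>Associativity pulls the start value out, so the fold over an appended list becomes the
  join of two folds, wherever the parentheses of a conjunction stand.\<close>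

lemma fold_join:
  "fold (\<lambda>q \<Omega>. join \<Omega> (f q)) qs \<Omega> = join \<Omega> (fold (\<lambda>q \<Omega>. join \<Omega> (f q)) qs {Map.empty})"
proof (induction qs arbitrary: \<Omega>)
  case (Cons q qs)
  show ?case
    using Cons[of "join \<Omega> (f q)"] Cons[of "f q"] by (simp add: join_assoc)
qed simp

lemma qeval_conjunction:
  assumes "conjunction Q qs"
  shows "qeval data W Q S = joins data W qs S"
  using assms
proof (induction rule: conjunction.induct)
  case (2 Q\<^sub>1 qs\<^sub>1 Q\<^sub>2 qs\<^sub>2)
  then show ?case
    using fold_join[of "\<lambda>q. qeval data W q S" qs\<^sub>2 "joins data W qs\<^sub>1 S"] by simp
qed simp

text \<open>Multisets instead of sets: joining with the same set twice may yield new mappings, so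
  repeated conjuncts have to be kept.\<close>

lemma joins_permute:
  assumes "mset qs = mset qs'"
  shows "joins data W qs S = joins data W qs' S"
proof -
  have "fold (\<lambda>q \<Omega>. join \<Omega> (qeval data W q S)) qs = fold (\<lambda>q \<Omega>. join \<Omega> (qeval data W q S)) qs'"
    using assms
    by (intro fold_multiset_equiv)
      (auto simp: fun_eq_iff join_assoc join_commute[of "qeval data W _ S" "qeval data W _ S"])
  then show ?thesis
    by simp
qed

lemma sbvars_joins_dom:
  assumes "\<mu> \<in> joins data W qs S"
  shows "(\<Union>q\<in>set qs. sbvars q) \<subseteq> dom \<mu>"
  using assms
proof (induction qs arbitrary: \<mu> rule: rev_induct)
  case (snoc q qs)
  then have "\<mu> \<in> join (joins data W qs S) (qeval data W q S)"
    by simp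
  then have "(\<Union>q\<in>set qs. sbvars q) \<union> sbvars q \<subseteq> dom \<mu>"
    using snoc.IH sbvars_dom by (rule dom_join)
  then show ?case
    by auto
qed simp

section \<open>Weakest preconditions\<close>

text \<open>The set of lookups is hidden and only its finiteness kept, so conditions compose as for
  programs without lookups. \<open>Lookup\<close> gets no rule below because it occurs only inside
  the assumed programs.\<close>

definition wp :: "(tree \<Rightarrow> tree) \<Rightarrow> prog \<Rightarrow> (tree \<Rightarrow> bool) \<Rightarrow> tree \<Rightarrow> bool" where
  "wp ans p P x \<longleftrightarrow> (\<exists>L y. run ans p x L y \<and> finite L \<and> P y)"

lemma wp_mono: "wp ans p P x \<Longrightarrow> (\<And>y. P y \<Longrightarrow> P' y) \<Longrightarrow> wp ans p P' x"
  unfolding wp_def by blast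

inductive_cases run_elims:
  "run ans Ident x L y" "run ans Empty x L y" "run ans Left x L y" "run ans Right x L y"
  "run ans Equal x L y" "run ans (Both p q) x L y" "run ans (Then p q) x L y"
  "run ans (Cond c p q) x L y"

lemma wp_basic:
  "wp ans Ident P x \<longleftrightarrow> P x"
  "wp ans Empty P x \<longleftrightarrow> P Leaf"
  "wp ans Left P x \<longleftrightarrow> P (left x)"
  "wp ans Right P x \<longleftrightarrow> P (right x)"
  "wp ans Equal P x \<longleftrightarrow> P (if left x = right x then Node Leaf Leaf else Leaf)"
  unfolding wp_def
  by (blast intro: run.Ident run.Empty run.Left run.Right run.Equal elim: run_elims)+

lemma wp_Both:
  "wp ans (Both p q) P x \<longleftrightarrow> wp ans p (\<lambda>y. wp ans q (\<lambda>z. P (Node y z)) x) x" (is "?l \<longleftrightarrow> ?r")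
proof
  assume ?l
  then obtain L y where "run ans (Both p q) x L y" "finite L" "P y"
    unfolding wp_def by blast
  then show ?r
    unfolding wp_def by (elim run_elims; simp; blast)
next
  assume ?r
  then obtain L y M z where "run ans p x L y" "finite L" "run ans q x M z" "finite M" "P (Node y z)"
    unfolding wp_def by blast
  then show ?l
    unfolding wp_def using run.Both finite_UnI by blast
qed

lemma wp_Then:
  "wp ans (Then p q) P x \<longleftrightarrow> wp ans p (wp ans q P) x" (is "?l \<longleftrightarrow> ?r")
proof
  assume ?l
  then obtain L y where "run ans (Then p q) x L y" "finite L" "P y"
    unfolding wp_def by blast
  then show ?r
    unfolding wp_def by (elim run_elims; simp; blast)
next
  assume ?r
  then obtain L y M z where "run ans p x L y" "finite L" "run ans q y M z" "finite M" "P z"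
    unfolding wp_def by blast
  then show ?l
    unfolding wp_def using run.Then finite_UnI by blast
qed

lemma wp_Cond:
  "wp ans (Cond c p q) P x \<longleftrightarrow>
    wp ans c (\<lambda>b. if b = Leaf then wp ans q P x else wp ans p P x) x" (is "?l \<longleftrightarrow> ?r")
proof
  assume ?l
  then obtain L y where "run ans (Cond c p q) x L y" "finite L" "P y"
    unfolding wp_def by blast
  then show ?r
  proof (elim run_elims)
    fix K b M
    assume "L = K \<union> M" "run ans c x K b" "b \<noteq> Leaf" "run ans p x M y" "finite L" "P y"
    then show ?r
      unfolding wp_def by (intro exI[of _ K] exI[of _ b]) auto
  next
    fix K M
    assume "L = K \<union> M" "run ans c x K Leaf" "run ans q x M y" "finite L" "P y"
    then show ?r
      unfolding wp_def by (intro exI[of _ K] exI[of _ Leaf]) auto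
  qed
next
  assume ?r
  then obtain K b where K: "run ans c x K b" "finite K"
    and b: "if b = Leaf then wp ans q P x else wp ans p P x"
    unfolding wp_def[of _ c] by blast
  show ?l
  proof (cases "b = Leaf")
    case True
    then obtain M y where "run ans q x M y" "finite M" "P y"
      using b unfolding wp_def by auto
    then show ?thesis
      using K True run.Cond_false finite_UnI unfolding wp_def by blast
  next
    case False
    then obtain M y where "run ans p x M y" "finite M" "P y"
      using b unfolding wp_def by auto
    then show ?thesis
      using K False run.Cond_true finite_UnI unfolding wp_def by blast
  qed
qed

text \<open>Equations between predicates, so that the simplifier also reaches the inner \<open>wp\<close> in \<open>wp ans p (wp ans q P)\<close>.\<close>

lemma wp_simps [simp]:
  "wp ans Ident P = P"
  "wp ans Empty P = (\<lambda>x. P Leaf)"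
  "wp ans Left P = (\<lambda>x. P (left x))"
  "wp ans Right P = (\<lambda>x. P (right x))"
  "wp ans Equal P = (\<lambda>x. P (if left x = right x then Node Leaf Leaf else Leaf))"
  "wp ans (Both p q) P = (\<lambda>x. wp ans p (\<lambda>y. wp ans q (\<lambda>z. P (Node y z)) x) x)"
  "wp ans (Then p q) P = wp ans p (wp ans q P)"
  "wp ans (Cond c p q) P =
    (\<lambda>x. wp ans c (\<lambda>b. if b = Leaf then wp ans q P x else wp ans p P x) x)"
  by (simp_all only: fun_eq_iff wp_basic wp_Both wp_Then wp_Cond) simp_all

text \<open>Loops get introduction rules rather than an equation, which could be unfolded forever.
  Termination comes from induction over the list that a loop consumes.\<close>

lemma wp_Loop_end:
  assumes "wp ans c (\<lambda>b. b = Leaf) x" "P x"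
  shows "wp ans (Loop c p) P x"
  using assms run.Loop_end unfolding wp_def by blast

lemma wp_Loop_step:
  assumes "wp ans c (\<lambda>b. b \<noteq> Leaf) x" "wp ans p (wp ans (Loop c p) P) x"
  shows "wp ans (Loop c p) P x"
proof -
  obtain K b where "run ans c x K b" "finite K" "b \<noteq> Leaf"
    using assms(1) unfolding wp_def by blast
  moreover obtain L y M z where
    "run ans p x L y" "finite L" "run ans (Loop c p) y M z" "finite M" "P z"
    using assms(2) unfolding wp_def by blast
  ultimately show ?thesis
    using run.Loop_step finite_UnI unfolding wp_def by blast
qed

section \<open>Trees as lists\<close>

text \<open>Every tree is a list, read along its right spine, so no well-formedness condition on
  lists arises.\<close>

primrec elems :: "tree \<Rightarrow> tree set" where
  "elems Leaf = {}"
| "elems (Node a b) = insert a (elems b)"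

lemma elems_list_tree [simp]: "elems (list_tree xs) = set xs"
  by (induction xs) auto

lemma list_tree_surj: "\<exists>xs. t = list_tree xs"
proof (induction t)
  case Leaf
  show ?case by (metis list_tree.simps(1))
next
  case (Node a b)
  then show ?case by (metis list_tree.simps(2))
qed

text \<open>A query is fixed before its program is, so the code of a variable can be
  hard-wired.\<close>

primrec const_prog :: "tree \<Rightarrow> prog" where
  "const_prog Leaf = Empty"
| "const_prog (Node a b) = Both (const_prog a) (const_prog b)"

lemma wp_const_prog [simp]: "wp ans (const_prog t) P = (\<lambda>x. P t)"
  by (induction t arbitrary: P) auto

text \<open>
  The input is \<open>Node e (Node t a)\<close> with environment \<open>e\<close>, list \<open>t\<close> and accumulator \<open>a\<close>; the body
  maps \<open>Node e (Node i a)\<close> for an item \<open>i\<close> of the list to the new accumulator.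
\<close>

definition fold_prog :: "prog \<Rightarrow> prog" where
  "fold_prog p = Then
     (Loop (Then Right Left)
       (Both Left (Both (Then Right (Then Left Right))
         (Then (Both Left (Both (Then Right (Then Left Left)) (Then Right Right))) p))))
     (Then Right Right)"

text \<open>The invariant sees the set \<open>A\<close> of items read, not a position. As items may
  recur, \<open>A\<close> and the rest of the list may overlap, and \<open>i\<close> may already be
  in \<open>A\<close>.\<close>

lemma wp_fold_prog:
  assumes "Inv {} a"
    and "\<And>A i b. i \<in> elems t \<Longrightarrow> A \<subseteq> elems t \<Longrightarrow> Inv A b \<Longrightarrow>
      wp ans p (Inv (insert i A)) (Node e (Node i b))"
    and "\<And>c. Inv (elems t) c \<Longrightarrow> P c"
  shows "wp ans (fold_prog p) P (Node e (Node t a))"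
proof -
  let ?loop = "Loop (Then Right Left)
       (Both Left (Both (Then Right (Then Left Right))
         (Then (Both Left (Both (Then Right (Then Left Left)) (Then Right Right))) p)))"
  have "wp ans ?loop (\<lambda>x. P (right (right x))) (Node e (Node s b))"
    if "Inv A b" "A \<union> elems s = elems t" for s A b
    using that
  proof (induction s arbitrary: A b)
    case Leaf
    then show ?case
      using assms(3) by (intro wp_Loop_end) auto
  next
    case (Node i s)
    have "wp ans p (Inv (insert i A)) (Node e (Node i b))"
      using Node.prems by (intro assms(2)) auto
    moreover have "wp ans ?loop (\<lambda>x. P (right (right x))) (Node e (Node s c))"
      if "Inv (insert i A) c" for c
      using that Node.prems by (intro Node.IH(2)) auto
    ultimately have "wp ans p (\<lambda>c. wp ans ?loop (\<lambda>x. P (right (right x))) (Node e (Node s c)))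
        (Node e (Node i b))"
      by (rule wp_mono)
    then show ?case
      by (intro wp_Loop_step) simp_all
  qed
  from this[of "{}" a t] show ?thesis
    using assms(1) by (simp add: fold_prog_def)
qed

section \<open>Representations\<close>

lemma nat_tree_inj: "nat_tree m = nat_tree n \<longleftrightarrow> m = n"
proof (induction m arbitrary: n)
  case 0
  show ?case by (cases n) simp_all
next
  case (Suc m)
  then show ?case by (cases n) simp_all
qed

lemma code_inj [simp]: "code x = code y \<longleftrightarrow> x = y"
  by (simp add: code_def nat_tree_inj)

lemma node_tree_inj [simp]: "node_tree x = node_tree y \<longleftrightarrow> x = y"
  by (cases x; cases y) (simp_all add: numeral_2_eq_2)

lemma inj_binding_tree: "inj binding_tree"
  by (rule injI) auto

text \<open>Injectivity of \<open>binding_tree\<close> lets every entry be decoded, so the listing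
  demanded by the definition is recovered from the entries of \<open>t\<close>.\<close>

lemma represents_mapping_iff:
  fixes \<mu> :: "('u::{countable, infinite}, 'b::{countable, infinite}, 'l::{countable, infinite},
    'v::{countable, infinite}) mapping"
  shows "represents_mapping t \<mu> \<longleftrightarrow> elems t = binding_tree ` Map.graph \<mu>"
proof
  assume *: "elems t = binding_tree ` Map.graph \<mu>"
  obtain xs where xs: "t = list_tree xs"
    using list_tree_surj by blast
  define f where "f = inv (binding_tree :: 'v \<times> ('u, 'b, 'l) node \<Rightarrow> tree)"
  have f: "f (binding_tree b) = b" for b
    unfolding f_def by (rule inv_f_f[OF inj_binding_tree])
  have "binding_tree (f x) = x" if "x \<in> set xs" for x
    using that * f unfolding xs elems_list_tree by auto
  then have "t = list_tree (map binding_tree (map f xs))"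
    by (simp add: xs map_idI)
  moreover have "set (map f xs) = Map.graph \<mu>"
    using * unfolding xs elems_list_tree set_map by (simp add: image_image f)
  ultimately show "represents_mapping t \<mu>"
    unfolding represents_mapping_def by blast
next
  assume "represents_mapping t \<mu>"
  then show "elems t = binding_tree ` Map.graph \<mu>"
    unfolding represents_mapping_def by (metis elems_list_tree set_map)
qed

lemma represents_mapping_elem:
  assumes "represents_mapping t \<mu>"
  shows "b \<in> elems t \<longleftrightarrow> (\<exists>v n. \<mu> v = Some n \<and> b = Node (code v) (node_tree n))"
  using assms by (force simp: represents_mapping_iff Map.graph_def)

lemma represents_mapping_unique:
  assumes "represents_mapping t \<mu>" "represents_mapping t \<nu>"
  shows "\<mu> = \<nu>"
proof -
  have "\<mu> v = Some n \<longleftrightarrow> \<nu> v = Some n" for v n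
    using represents_mapping_elem[OF assms(1), of "Node (code v) (node_tree n)"]
      represents_mapping_elem[OF assms(2), of "Node (code v) (node_tree n)"] by auto
  then show ?thesis
    by (metis ext option.exhaust)
qed

text \<open>Decodes the part of a result that a loop has read so far, for use in its
  invariant.\<close>

definition mappings :: "tree set \<Rightarrow>
    ('u::{countable, infinite}, 'b::{countable, infinite}, 'l::{countable, infinite},
     'v::{countable, infinite}) mapping set" where
  "mappings A = {\<mu>. \<exists>t\<in>A. represents_mapping t \<mu>}"

text \<open>The second conjunct alone would tolerate entries that represent no mapping; the first
  excludes them.\<close>

lemma represents_result_iff:
  "represents_result y \<Omega> \<longleftrightarrow>
    (\<forall>t\<in>elems y. \<exists>\<mu>\<in>\<Omega>. represents_mapping t \<mu>) \<and> mappings (elems y) = \<Omega>"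
proof
  assume "represents_result y \<Omega>"
  then obtain ts \<mu>s where *: "y = list_tree ts" "list_all2 represents_mapping ts \<mu>s" "set \<mu>s = \<Omega>"
    unfolding represents_result_def by blast
  have "\<forall>t\<in>set ts. \<exists>\<mu>\<in>\<Omega>. represents_mapping t \<mu>" "\<forall>\<mu>\<in>\<Omega>. \<exists>t\<in>set ts. represents_mapping t \<mu>"
    using * by (auto simp: list_all2_conv_all_nth in_set_conv_nth) (metis nth_mem)+
  then show "(\<forall>t\<in>elems y. \<exists>\<mu>\<in>\<Omega>. represents_mapping t \<mu>) \<and> mappings (elems y) = \<Omega>"
    using * by (auto simp: mappings_def) (metis represents_mapping_unique)
next
  assume *: "(\<forall>t\<in>elems y. \<exists>\<mu>\<in>\<Omega>. represents_mapping t \<mu>) \<and> mappings (elems y) = \<Omega>"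
  then obtain f where f: "\<forall>t\<in>elems y. f t \<in> \<Omega> \<and> represents_mapping t (f t)"
    by metis
  obtain ts where ts: "y = list_tree ts"
    using list_tree_surj by blast
  have "list_all2 represents_mapping ts (map f ts)"
    using f ts by (auto simp: list_all2_conv_all_nth)
  moreover have "set (map f ts) = \<Omega>"
    using f ts * represents_mapping_unique by (fastforce simp: mappings_def)
  ultimately show "represents_result y \<Omega>"
    unfolding represents_result_def ts by blast
qed

lemma represents_result_elem:
  assumes "represents_result y \<Omega>" "t \<in> elems y"
  obtains \<mu> where "represents_mapping t \<mu>" "\<mu> \<in> \<Omega>"
  using iffD1[OF represents_result_iff assms(1)] assms(2) by blast

lemma represents_result_mappings: "represents_result y \<Omega> \<Longrightarrow> mappings (elems y) = \<Omega>"
  by (rule conjunct2[OF iffD1[OF represents_result_iff]])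

lemma mappings_empty [simp]: "mappings {} = {}"
  by (simp add: mappings_def)

lemma mappings_insert: "represents_mapping t \<mu> \<Longrightarrow> mappings (insert t A) = insert \<mu> (mappings A)"
  using represents_mapping_unique by (fastforce simp: mappings_def)

lemma represents_result_Leaf: "represents_result Leaf {}"
  by (simp add: represents_result_iff)

lemma represents_result_Node:
  "represents_mapping t \<mu> \<Longrightarrow> represents_result y \<Omega> \<Longrightarrow> represents_result (Node t y) (insert \<mu> \<Omega>)"
  by (auto simp: represents_result_iff mappings_insert)

section \<open>Programs for joins\<close>

text \<open>The environment is one binding, the list holds the bindings of the other mapping, and
  the accumulator is a truth value. It drops to \<open>Leaf\<close> when the same variable has two
  different values, and then stays there.\<close>

definition agree_step_prog :: prog where
  "agree_step_prog =
     Cond (Then (Both (Then Left Left) (Then Right (Then Left Left))) Equal)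
       (Cond (Then (Both (Then Left Right) (Then Right (Then Left Right))) Equal)
         (Then Right Right) Empty)
       (Then Right Right)"

definition agree_prog :: prog where
  "agree_prog = Then (Both Right (Both Left (const_prog (Node Leaf Leaf))))
     (fold_prog (Then (Both (Then Right Left) (Both Left (Then Right Right)))
       (fold_prog agree_step_prog)))"

lemma wp_agree_prog:
  assumes "\<And>c. c \<noteq> Leaf \<longleftrightarrow>
      (\<forall>b\<in>elems t. \<forall>b'\<in>elems s. left b = left b' \<longrightarrow> right b = right b') \<Longrightarrow> P c"
  shows "wp ans agree_prog P (Node t s)"
proof -
  have inner: "wp ans (fold_prog agree_step_prog)
      (\<lambda>c. c \<noteq> Leaf \<longleftrightarrow> a \<noteq> Leaf \<and> (\<forall>b'\<in>elems s. left b = left b' \<longrightarrow> right b = right b'))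
      (Node b (Node s a))" for a b
    by (rule wp_fold_prog[where Inv = "\<lambda>A c. c \<noteq> Leaf \<longleftrightarrow>
          a \<noteq> Leaf \<and> (\<forall>b'\<in>A. left b = left b' \<longrightarrow> right b = right b')"])
      (auto simp: agree_step_prog_def)
  show ?thesis
    unfolding agree_prog_def
    apply simp
    apply (rule wp_fold_prog[where Inv = "\<lambda>A c. c \<noteq> Leaf \<longleftrightarrow>
          (\<forall>b\<in>A. \<forall>b'\<in>elems s. left b = left b' \<longrightarrow> right b = right b')"])
      apply simp
     apply simp
     apply (rule wp_mono[OF inner])
     apply auto[1]
    apply (rule assms)
    apply simp
    done
qed

lemma wp_agree_prog_compatible:
  assumes "represents_mapping t \<mu>" "represents_mapping s \<nu>"
    and "\<And>c. c \<noteq> Leaf \<longleftrightarrow> compatible \<mu> \<nu> \<Longrightarrow> P c"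
  shows "wp ans agree_prog P (Node t s)"
proof (rule wp_agree_prog, rule assms(3))
  fix c
  assume "c \<noteq> Leaf \<longleftrightarrow>
      (\<forall>b\<in>elems t. \<forall>b'\<in>elems s. left b = left b' \<longrightarrow> right b = right b')"
  moreover have "(\<forall>b\<in>elems t. \<forall>b'\<in>elems s. left b = left b' \<longrightarrow> right b = right b') \<longleftrightarrow>
      compatible \<mu> \<nu>"
    unfolding Ball_def represents_mapping_elem[OF assms(1)] represents_mapping_elem[OF assms(2)]
      compatible_iff by fastforce
  ultimately show "c \<noteq> Leaf \<longleftrightarrow> compatible \<mu> \<nu>"
    by simp
qed

text \<open>\<open>Right\<close> turns \<open>Node e (Node i b)\<close> into
  \<open>Node i b\<close>, which is consing \<open>i\<close> to the accumulator.\<close>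

lemma wp_union:
  assumes "\<And>c. elems c = elems t \<union> elems a \<Longrightarrow> P c"
  shows "wp ans (fold_prog Right) P (Node e (Node t a))"
  by (rule wp_fold_prog[where Inv = "\<lambda>A c. elems c = A \<union> elems a"]) (auto intro: assms)

text \<open>Compatibility makes the union of the two graphs the graph of a mapping; bindings shared
  by both sides merely occur repeatedly in the list.\<close>

lemma represents_mapping_add:
  assumes "represents_mapping t \<mu>" "represents_mapping s \<nu>" "compatible \<mu> \<nu>"
    and "elems c = elems t \<union> elems s"
  shows "represents_mapping c (\<mu> ++ \<nu>)"
proof -
  have "Map.graph (\<mu> ++ \<nu>) = Map.graph \<mu> \<union> Map.graph \<nu>"
    using assms(3) by (fastforce simp: Map.graph_def compatible_iff map_add_Some_iff)
  then show ?thesis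
    using assms by (simp add: represents_mapping_iff image_Un)
qed

definition join_step_prog :: prog where
  "join_step_prog = Cond (Then (Both Left (Then Right Left)) agree_prog)
     (Both (Then (Both Empty (Both Left (Then Right Left))) (fold_prog Right)) (Then Right Right))
     (Then Right Right)"

lemma wp_join_step_prog:
  assumes "represents_mapping t \<mu>" "represents_mapping s \<nu>" "represents_result a \<Omega>"
  shows "wp ans join_step_prog (\<lambda>c. represents_result c (\<Omega> \<union> join {\<mu>} {\<nu>}))
    (Node t (Node s a))"
  unfolding join_step_prog_def
  apply simp
  apply (rule wp_agree_prog_compatible[OF assms(1,2)])
  apply (cases "compatible \<mu> \<nu>")
   apply simp
   apply (rule wp_union)
   apply (simp add: join_def)
   apply (rule represents_result_Node[OF _ assms(3)])
   apply (rule represents_mapping_add[OF assms(1,2)], assumption, assumption)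
  apply (simp add: join_def assms(3))
  done

lemma wp_join_one:
  assumes "represents_mapping t \<mu>" "represents_result s \<Omega>'" "represents_result a \<Omega>"
  shows "wp ans (fold_prog join_step_prog) (\<lambda>c. represents_result c (\<Omega> \<union> join {\<mu>} \<Omega>'))
    (Node t (Node s a))"
proof (rule wp_fold_prog[where Inv = "\<lambda>A c. represents_result c (\<Omega> \<union> join {\<mu>} (mappings A))"])
  show "represents_result a (\<Omega> \<union> join {\<mu>} (mappings {}))"
    using assms(3) by (simp add: join_def)
  show "wp ans join_step_prog (\<lambda>c. represents_result c (\<Omega> \<union> join {\<mu>} (mappings (insert i A))))
      (Node t (Node i b))"
    if i: "i \<in> elems s" and b: "represents_result b (\<Omega> \<union> join {\<mu>} (mappings A))"
    for A i b
  proof -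
    obtain \<nu> where \<nu>: "represents_mapping i \<nu>" "\<nu> \<in> \<Omega>'"
      by (rule represents_result_elem[OF assms(2) i])
    have "join {\<mu>} (insert \<nu> (mappings A)) = join {\<mu>} (mappings A) \<union> join {\<mu>} {\<nu>}"
      by (auto simp: join_def)
    then show ?thesis
      using wp_join_step_prog[OF assms(1) \<nu>(1) b, of ans]
      by (simp add: mappings_insert[OF \<nu>(1)] Un_assoc)
  qed
  show "represents_result c (\<Omega> \<union> join {\<mu>} (mappings (elems s))) \<Longrightarrow>
      represents_result c (\<Omega> \<union> join {\<mu>} \<Omega>')" for c
    by (simp add: represents_result_mappings[OF assms(2)])
qed

text \<open>
  The input consists of the seeds and a list of mappings; \<open>g\<close> computes the candidate partners of
  a single mapping.
\<close>

definition extend_prog :: "prog \<Rightarrow> prog" where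
  "extend_prog g = Then (Both Left (Both Right Empty))
     (fold_prog (Then (Both (Then Right Left)
         (Both (Then (Both Left (Then Right Left)) g) (Then Right Right)))
       (fold_prog join_step_prog)))"

text \<open>Letting the partners \<open>F \<mu>\<close> depend on the mapping covers both kinds of
  conjuncts: \<open>F\<close> is constant for a Web-safe one and given by the value of
  \<open>?v\<close> in \<open>\<mu>\<close> for \<open>SEED ?v q\<close>.\<close>

lemma wp_extend_prog:
  assumes "represents_result T \<Omega>"
    and "\<And>t \<mu>. \<mu> \<in> \<Omega> \<Longrightarrow> represents_mapping t \<mu> \<Longrightarrow>
      wp ans g (\<lambda>y. represents_result y (F \<mu>)) (Node x t)"
  shows "wp ans (extend_prog g) (\<lambda>y. represents_result y (\<Union>\<mu>\<in>\<Omega>. join {\<mu>} (F \<mu>))) (Node x T)"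
proof -
  let ?p = "Then (Both (Then Right Left)
         (Both (Then (Both Left (Then Right Left)) g) (Then Right Right)))
       (fold_prog join_step_prog)"
  let ?Inv = "\<lambda>A c. represents_result c (\<Union>\<mu>\<in>mappings A. join {\<mu>} (F \<mu>))"
  have "wp ans (fold_prog ?p) (\<lambda>y. represents_result y (\<Union>\<mu>\<in>\<Omega>. join {\<mu>} (F \<mu>)))
      (Node x (Node T Leaf))"
  proof (rule wp_fold_prog[where Inv = ?Inv])
    show "?Inv {} Leaf"
      by (simp add: represents_result_Leaf)
    show "wp ans ?p (?Inv (insert i A)) (Node x (Node i b))"
      if i: "i \<in> elems T" and b: "?Inv A b" for A i b
    proof -
      obtain \<mu> where \<mu>: "represents_mapping i \<mu>" "\<mu> \<in> \<Omega>"
        by (rule represents_result_elem[OF assms(1) i])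
      show ?thesis
        using wp_mono[OF assms(2)[OF \<mu>(2,1)] wp_join_one[OF \<mu>(1) _ b]]
        by (simp add: mappings_insert[OF \<mu>(1)] Un_commute)
    qed
    show "represents_result c (\<Union>\<mu>\<in>\<Omega>. join {\<mu>} (F \<mu>))" if "?Inv (elems T) c" for c
      using that by (simp add: represents_result_mappings[OF assms(1)])
  qed
  then show ?thesis
    by (simp add: extend_prog_def)
qed

section \<open>Seeding a query at the value of a variable\<close>

definition find_prog :: "tree \<Rightarrow> prog" where
  "find_prog k = Then (Both Empty (Both Ident Empty))
     (fold_prog (Cond (Then (Both (Then Right (Then Left Left)) (const_prog k)) Equal)
       (Then Right (Then Left Right)) (Then Right Right)))"

text \<open>A mapping has only one binding for \<open>v\<close>, so neither order nor repetitions in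
  the list affect what is found.\<close>

lemma wp_find_prog:
  assumes "represents_mapping t \<mu>" "\<mu> v = Some n" "P (node_tree n)"
  shows "wp ans (find_prog (code v)) P t"
  unfolding find_prog_def
proof (simp, rule wp_fold_prog[where Inv = "\<lambda>A c. if Node (code v) (node_tree n) \<in> A
      then c = node_tree n else c = Leaf"], goal_cases)
  case (2 A i b)
  obtain v' n' where "\<mu> v' = Some n'" "i = Node (code v') (node_tree n')"
    using 2(1) represents_mapping_elem[OF assms(1)] by blast
  then show ?case
    using 2 assms(2) by (auto split: if_splits)
next
  case (3 c)
  then show ?case
    using assms represents_mapping_elem[OF assms(1)] by auto
qed simp

text \<open>The value found has the form \<open>Node tag c\<close>. The tag of a URI is
  \<open>nat_tree 0\<close>, which is \<open>Leaf\<close> and hence false, so \<open>Left\<close>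
  tests for a blank node or a literal; the output is then \<open>Leaf\<close>, the empty result.
  Otherwise \<open>Both Right Empty\<close> yields \<open>Node c Leaf\<close>, the listing of a
  single seed.\<close>

definition seed_prog :: "tree \<Rightarrow> prog \<Rightarrow> prog" where
  "seed_prog k p =
     Then (Then Right (find_prog k)) (Cond Left Empty (Then (Both Right Empty) p))"

section \<open>Composition of the conjuncts\<close>

definition is_input ::
  "('d::{countable, infinite} \<Rightarrow>
     ('u::{countable, infinite}, 'b::{countable, infinite}, 'l::{countable, infinite}) triple set)
   \<Rightarrow> ('u, 'd) web \<Rightarrow> 'u set \<Rightarrow> (tree \<Rightarrow> tree) \<Rightarrow> tree \<Rightarrow> bool" where
  "is_input data W S ans x \<longleftrightarrow>
     is_web W \<and> finite S \<and> answers data W ans \<and> represents_uris x S"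

lemma web_safe_iff:
  "web_safe data q \<longleftrightarrow> (\<exists>p. \<forall>W S ans x. is_input data W S ans x \<longrightarrow>
     wp ans p (\<lambda>y. represents_result y (qeval data W q S)) x)"
  unfolding web_safe_def wp_def is_input_def by meson

text \<open>Web-safeness speaks of all seed sets, so a program may be run, on the same Web, at a
  seed found during the computation.\<close>

lemma is_input_singleton:
  "is_input data W S ans x \<Longrightarrow> is_input data W {u} ans (Node (code u) Leaf)"
  unfolding is_input_def represents_uris_def
  by (auto intro!: exI[of _ "[u]"])

lemma wp_seed_prog:
  assumes p: "\<And>u. wp ans p (\<lambda>y. represents_result y (qeval data W q {u})) (Node (code u) Leaf)"
    and t: "represents_mapping t \<mu>" "\<mu> v = Some n"
  shows "wp ans (seed_prog (code v) p)
    (\<lambda>y. represents_result y (case n of Uri u \<Rightarrow> qeval data W q {u} | _ \<Rightarrow> {})) (Node x t)"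
  unfolding seed_prog_def
  using p by (cases n) (auto intro!: wp_find_prog[OF t] represents_result_Leaf simp: numeral_2_eq_2)

text \<open>The union over all URIs becomes one over \<open>\<Omega>\<close>, in the shape that
  \<open>wp_extend_prog\<close> computes.\<close>

lemma join_seedvar:
  assumes "\<And>\<mu>. \<mu> \<in> \<Omega> \<Longrightarrow> v \<in> dom \<mu>"
  shows "join \<Omega> (qeval data W (SeedVar v q) S) =
    (\<Union>\<mu>\<in>\<Omega>. join {\<mu>} (case the (\<mu> v) of Uri u \<Rightarrow> qeval data W q {u} | _ \<Rightarrow> {}))"
proof -
  have "join {\<mu>} (qeval data W (SeedVar v q) S) =
      join {\<mu>} (case the (\<mu> v) of Uri u \<Rightarrow> qeval data W q {u} | _ \<Rightarrow> {})" if \<mu>: "\<mu> \<in> \<Omega>" for \<mu>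
  proof -
    obtain n where n: "\<mu> v = Some n"
      using assms[OF \<mu>] by blast
    have "join {\<mu>} (qeval data W (SeedVar v q) S) =
        (\<Union>u. join {\<mu>} (join (qeval data W q {u}) {[v \<mapsto> Uri u]}))"
      by (simp add: join_UN_right)
    also have "\<dots> = (\<Union>u. if n = Uri u then join {\<mu>} (qeval data W q {u}) else {})"
      using n by (intro SUP_cong) (auto simp: join_seed join_seed_mismatch)
    also have "\<dots> = join {\<mu>} (case n of Uri u \<Rightarrow> qeval data W q {u} | _ \<Rightarrow> {})"
      by (cases n) (auto simp: join_def)
    finally show ?thesis
      using n by simp
  qed
  then show ?thesis
    by (subst join_UN_left) simp
qed

text \<open>The order is abstracted to the set \<open>V\<close> of variables bound so far. This is
  monotone in \<open>V\<close>, so a conjunct may be preceded by more than its predecessors.\<close>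

definition safe_after ::
  "('d::{countable, infinite} \<Rightarrow>
     ('u::{countable, infinite}, 'b::{countable, infinite}, 'l::{countable, infinite}) triple set)
   \<Rightarrow> 'v set \<Rightarrow> ('u, 'l, 'v::{countable, infinite}) query \<Rightarrow> bool" where
  "safe_after data V q \<longleftrightarrow>
     web_safe data q \<or> (\<exists>v q'. q = SeedVar v q' \<and> web_safe data q' \<and> v \<in> V)"

lemma safe_after_mono: "safe_after data V q \<Longrightarrow> V \<subseteq> V' \<Longrightarrow> safe_after data V' q"
  unfolding safe_after_def by blast

lemma safe_after_extend:
  fixes data :: "'d::{countable, infinite} \<Rightarrow>
      ('u::{countable, infinite}, 'b::{countable, infinite}, 'l::{countable, infinite}) triple set"
    and q :: "('u, 'l, 'v::{countable, infinite}) query"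
  assumes "safe_after data V q"
  shows "\<exists>g. \<forall>W S ans x T \<Omega>. is_input data W S ans x \<longrightarrow> represents_result T \<Omega> \<longrightarrow>
    (\<forall>\<mu>\<in>\<Omega>. V \<subseteq> dom \<mu>) \<longrightarrow>
    wp ans (extend_prog g) (\<lambda>y. represents_result y (join \<Omega> (qeval data W q S))) (Node x T)"
proof -
  consider "web_safe data q" | v q' where "q = SeedVar v q'" "web_safe data q'" "v \<in> V"
    using assms unfolding safe_after_def by blast
  then show ?thesis
  proof cases
    case 1
    then obtain p where p: "\<And>W S ans x. is_input data W S ans x \<Longrightarrow>
        wp ans p (\<lambda>y. represents_result y (qeval data W q S)) x"
      unfolding web_safe_iff by blast
    \<comment> \<open>The program ignores the mapping and evaluates \<open>q\<close> at the original
      seeds anew for each one, which makes \<open>F\<close> constant.\<close>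
    show ?thesis
      by (rule exI[of _ "Then Left p"], subst join_UN_left)
        (auto intro!: wp_extend_prog simp: p)
  next
    case 2
    from 2(2) obtain p where p: "\<And>W S ans x. is_input data W S ans x \<Longrightarrow>
        wp ans p (\<lambda>y. represents_result y (qeval data W q' S)) x"
      unfolding web_safe_iff by blast
    have "wp ans (extend_prog (seed_prog (code v) p))
        (\<lambda>y. represents_result y (join \<Omega> (qeval data W q S))) (Node x T)"
      if x: "is_input data W S ans x" and T: "represents_result T \<Omega>" and V: "\<forall>\<mu>\<in>\<Omega>. V \<subseteq> dom \<mu>"
      for W S ans x T and \<Omega> :: "('u, 'b, 'l, 'v) mapping set"
    proof -
      have v: "v \<in> dom \<mu>" if "\<mu> \<in> \<Omega>" for \<mu>
        using that 2(3) V by blast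
      have "join \<Omega> (qeval data W (SeedVar v q') S) =
          (\<Union>\<mu>\<in>\<Omega>. join {\<mu>} (case the (\<mu> v) of Uri u \<Rightarrow> qeval data W q' {u} | _ \<Rightarrow> {}))"
        using v by (rule join_seedvar)
      then show ?thesis
        unfolding 2(1)
      proof (elim ssubst, intro wp_extend_prog[OF T])
        fix t \<mu>
        assume \<mu>: "\<mu> \<in> \<Omega>" "represents_mapping t \<mu>"
        obtain n where n: "\<mu> v = Some n"
          using v[OF \<mu>(1)] by blast
        show "wp ans (seed_prog (code v) p) (\<lambda>y. represents_result y
            (case the (\<mu> v) of Uri u \<Rightarrow> qeval data W q' {u} | _ \<Rightarrow> {})) (Node x t)"
          using wp_seed_prog[OF p[OF is_input_singleton[OF x]] \<mu>(2) n] by (simp add: n)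
      qed
    qed
    then show ?thesis
      by blast
  qed
qed

lemma joins_program:
  fixes data :: "'d::{countable, infinite} \<Rightarrow>
      ('u::{countable, infinite}, 'b::{countable, infinite}, 'l::{countable, infinite}) triple set"
    and qs :: "('u, 'l, 'v::{countable, infinite}) query list"
  assumes "\<And>qs\<^sub>1 q qs\<^sub>2. qs = qs\<^sub>1 @ q # qs\<^sub>2 \<Longrightarrow> safe_after data (\<Union>q\<in>set qs\<^sub>1. sbvars q) q"
  shows "\<exists>p. \<forall>W S ans x. is_input data W S ans x \<longrightarrow>
    wp ans p (\<lambda>y. represents_result y (joins data W qs S)) x"
  using assms
proof (induction qs rule: rev_induct)
  case Nil
  have "represents_mapping Leaf (Map.empty :: ('u, 'b, 'l, 'v) mapping)"
    by (simp add: represents_mapping_iff)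
  \<comment> \<open>\<open>Node Leaf Leaf\<close> lists just the empty mapping, giving the unit of
    join; \<open>Leaf\<close> would be a result without solutions.\<close>
  then have "represents_result (Node Leaf Leaf) {Map.empty :: ('u, 'b, 'l, 'v) mapping}"
    using represents_result_Node represents_result_Leaf by blast
  then show ?case
    by (intro exI[of _ "const_prog (Node Leaf Leaf)"]) simp
next
  case (snoc q qs)
  have "safe_after data (\<Union>q\<in>set qs\<^sub>1. sbvars q) q'" if "qs = qs\<^sub>1 @ q' # qs\<^sub>2" for qs\<^sub>1 q' qs\<^sub>2
    using that by (intro snoc.prems[of qs\<^sub>1 q' "qs\<^sub>2 @ [q]"]) simp
  then obtain p where p: "\<And>W S ans x. is_input data W S ans x \<Longrightarrow>
      wp ans p (\<lambda>y. represents_result y (joins data W qs S)) x"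
    using snoc.IH by blast
  have "safe_after data (\<Union>q\<in>set qs. sbvars q) q"
    by (rule snoc.prems[of qs q "[]"]) simp
  from safe_after_extend[OF this] obtain g where g:
    "\<And>W S ans x T (\<Omega> :: ('u, 'b, 'l, 'v) mapping set).
      is_input data W S ans x \<Longrightarrow> represents_result T \<Omega> \<Longrightarrow>
      (\<forall>\<mu>\<in>\<Omega>. (\<Union>q\<in>set qs. sbvars q) \<subseteq> dom \<mu>) \<Longrightarrow>
      wp ans (extend_prog g) (\<lambda>y. represents_result y (join \<Omega> (qeval data W q S))) (Node x T)"
    by blast
  \<comment> \<open>\<open>Ident\<close> keeps the seeds beside the result of the earlier conjuncts,
    because the extension needs both.\<close>
  have "wp ans (Then (Both Ident p) (extend_prog g))
      (\<lambda>y. represents_result y (joins data W (qs @ [q]) S)) x"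
    if x: "is_input data W S ans x" for W S ans x
  proof -
    have "\<forall>\<mu>\<in>joins data W qs S. (\<Union>q\<in>set qs. sbvars q) \<subseteq> dom \<mu>"
      by (intro ballI sbvars_joins_dom)
    then have "wp ans (extend_prog g) (\<lambda>y. represents_result y (joins data W (qs @ [q]) S)) (Node x T)"
      if "represents_result T (joins data W qs S)" for T
      using g[OF x that] by simp
    with p[OF x] have "wp ans p (\<lambda>T. wp ans (extend_prog g)
        (\<lambda>y. represents_result y (joins data W (qs @ [q]) S)) (Node x T)) x"
      by (rule wp_mono)
    then show ?thesis
      by simp
  qed
  then show ?case
    by blast
qed

section \<open>Sorting the conjuncts along the given order\<close>

lemma sort_key_precedes:
  assumes "sort_key f qs = qs\<^sub>1 @ q # qs\<^sub>2" "q' \<in> set qs" "f q' < f q"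
  shows "q' \<in> set qs\<^sub>1"
proof -
  have "sorted (map f (qs\<^sub>1 @ q # qs\<^sub>2))"
    by (metis assms(1) sorted_sort_key)
  then have "\<forall>x\<in>set qs\<^sub>2. f q \<le> f x"
    by (simp add: sorted_append)
  moreover have "q' \<in> set (qs\<^sub>1 @ q # qs\<^sub>2)"
    by (metis assms(1,2) set_sort)
  ultimately show ?thesis
    using assms(3) by auto
qed

theorem theorem7:
  fixes data :: "'d::{countable, infinite} \<Rightarrow>
      ('u::{countable, infinite}, 'b::{countable, infinite}, 'l::{countable, infinite}) triple set"
    and Q :: "('u, 'l, 'v::{countable, infinite}) query"
    and qs :: "('u, 'l, 'v) query list"
  assumes "document_data data"
    and "wf_query Q"
    and "conjunction Q qs"
    and "\<exists>r. strict_linear_order_on (set qs) r \<and>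
          (\<forall>q\<^sub>i \<in> set qs.
             web_safe data q\<^sub>i \<or>
             (\<exists>v q. q\<^sub>i = SeedVar v q \<and> web_safe data q \<and>
                v \<in> (\<Union>q\<^sub>j \<in> {q\<^sub>j \<in> set qs. (q\<^sub>j, q\<^sub>i) \<in> r}. sbvars q\<^sub>j)))"
  shows "web_safe data Q"
proof -
  obtain r where r: "strict_linear_order_on (set qs) r"
    and safe: "\<And>q. q \<in> set qs \<Longrightarrow> safe_after data (\<Union>q'\<in>{q' \<in> set qs. (q', q) \<in> r}. sbvars q') q"
    using assms(4) unfolding safe_after_def by blast
  \<comment> \<open>Counting predecessors gives a key in a linear order, as \<open>sort_key\<close>
    requires. Transitivity and irreflexivity make it increase strictly along
    \<open>r\<close>.\<close>
  define rank where "rank q = card {q' \<in> set qs. (q', q) \<in> r}" for q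
  have rank: "rank q' < rank q" if "q' \<in> set qs" "(q', q) \<in> r" for q' q
    unfolding rank_def
  proof (rule psubset_card_mono)
    have "trans r" "irrefl r"
      using r by (auto simp: strict_linear_order_on_def)
    then show "{x \<in> set qs. (x, q') \<in> r} \<subset> {x \<in> set qs. (x, q) \<in> r}"
      using that by (auto dest: transD simp: irrefl_def)
  qed simp
  have "safe_after data (\<Union>q\<in>set qs\<^sub>1. sbvars q) q"
    if "sort_key rank qs = qs\<^sub>1 @ q # qs\<^sub>2" for qs\<^sub>1 q qs\<^sub>2
  proof -
    have "q \<in> set qs"
      by (metis that in_set_conv_decomp set_sort)
    \<comment> \<open>Only an inclusion: with repetitions in \<open>qs\<close>, the prefix may also
      contain copies of \<open>q\<close> itself.\<close>
    moreover have "{q' \<in> set qs. (q', q) \<in> r} \<subseteq> set qs\<^sub>1"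
      using sort_key_precedes[OF that] rank by blast
    ultimately show ?thesis
      by (intro safe_after_mono[OF safe] UN_mono) auto
  qed
  then have "\<exists>p. \<forall>W S ans x. is_input data W S ans x \<longrightarrow>
      wp ans p (\<lambda>y. represents_result y (joins data W (sort_key rank qs) S)) x"
    by (rule joins_program)
  then obtain p where p: "\<And>W S ans x. is_input data W S ans x \<Longrightarrow>
      wp ans p (\<lambda>y. represents_result y (joins data W (sort_key rank qs) S)) x"
    by blast
  have "joins data W (sort_key rank qs) S = qeval data W Q S" for W S
    unfolding qeval_conjunction[OF assms(3)] by (rule joins_permute) simp
  then show ?thesis
    unfolding web_safe_iff using p by (intro exI[of _ p]) simp
qed

end
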